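(* Let $\mathbb T=\mathbb R/\mathbb Z$, $\alpha\in\mathbb R\setminus\mathbb Q$, $A=\begin{pmatrix}1&1\\2&1\end{pmatrix}$, let $h=\binom{h_1}{h_2}:\mathbb T\to\mathbb T^2$ be continuous, and let $\phi:\mathbb T^2\times\mathbb T\to\mathbb T^2\times\mathbb T$ be given by $$\phi\left(\binom{x}{y},\omega\right)=\left(A\binom{x}{y}+h(\omega),\ \omega+\alpha\right).$$ Let $n_i=\deg(h_i)$ for $i=1,2$. If $n_2$ is odd, then there are no $g\in C(\mathbb T,\mathbb T^2)$ and positive integer $n$ such that $\phi^n(\mathrm{graph}(g))=\mathrm{graph}(g)$; that is, $\phi$ has no random periodic point whose graph is continuous.
   Context: $\deg(p)$ denotes the degree of a continuous map $p:\mathbb T\to\mathbb T$. For $g:\mathbb T\to\mathbb T^2$, $\mathrm{graph}(g)=\{(g(\omega),\omega):\omega\in\mathbb T\}\subset\mathbb T^2\times\mathbb T$. A random periodic point of $\phi$ is a Borel map $g:\mathbb T\to\mathbb T^2$ with $\phi^n(\mathrm{graph}(g))=\mathrm{graph}(g)$ for some $n\ge1$. $C(\mathbb T,\mathbb T^2)$ is the set of continuous maps. *)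

theory Defs
  imports "HOL-Analysis.Analysis"
begin

quotient_type circle = real / "\<lambda>x y. x - y \<in> \<int>" morphisms rep_circle circle_of
proof (rule equivpI)
  show "symp (\<lambda>x y :: real. x - y \<in> \<int>)"
  proof (rule sympI)
    fix x y :: real
    assume "x - y \<in> \<int>"
    then show "y - x \<in> \<int>"
      using Ints_minus[of "x - y"] by simp
  qed
  show "transp (\<lambda>x y :: real. x - y \<in> \<int>)"
  proof (rule transpI)
    fix x y z :: real
    assume "x - y \<in> \<int>" "y - z \<in> \<int>"
    then have "(x - y) + (y - z) \<in> \<int>"
      by (rule Ints_add)
    then show "x - z \<in> \<int>"
      by simp
  qed
qed (simp add: reflp_def)

instantiation circle :: ab_group_add
begin

lift_definition zero_circle :: circle is 0 .

lift_definition plus_circle :: "circle \<Rightarrow> circle \<Rightarrow> circle" is "(+)"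
proof -
  fix a b c d :: real
  assume "a - b \<in> \<int>" "c - d \<in> \<int>"
  then show "a + c - (b + d) \<in> \<int>"
    using Ints_add by (simp only: add_diff_add)
qed

lift_definition uminus_circle :: "circle \<Rightarrow> circle" is uminus
  using Ints_minus by (simp only: minus_diff_minus)

lift_definition minus_circle :: "circle \<Rightarrow> circle \<Rightarrow> circle" is "(-)"
proof -
  fix a b c d :: real
  assume "a - b \<in> \<int>" "c - d \<in> \<int>"
  then have "(a - b) - (c - d) \<in> \<int>"
    by (rule Ints_diff)
  then show "a - c - (b - d) \<in> \<int>"
    by (simp add: algebra_simps)
qed

instance
  by standard (transfer; simp)+

end

instantiation circle :: topological_space
begin

text \<open>The quotient topology.\<close>

definition open_circle :: "circle set \<Rightarrow> bool" where
  "open_circle U \<longleftrightarrow> open (circle_of -` U)"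

instance
  by standard (auto simp: open_circle_def vimage_Union intro!: open_UN)

end

lift_definition circle_scale :: "int \<Rightarrow> circle \<Rightarrow> circle" is "\<lambda>k x. of_int k * x"
  using Ints_mult[OF Ints_of_int] by (simp only: flip: right_diff_distrib)

text \<open>The endomorphism of the torus induced by an integer matrix.\<close>

definition torus_endo :: "int ^ 'n ^ 'm \<Rightarrow> circle ^ 'n \<Rightarrow> circle ^ 'm" where
  "torus_endo A v = (\<chi> i. \<Sum>j\<in>UNIV. circle_scale (A $ i $ j) (v $ j))"

text \<open>The degree of a continuous \<open>p\<close>, read off from any continuous lift \<open>P\<close> of \<open>p\<close> to the real line;
  \<open>circle_degree_unique\<close> below shows that it is well defined. The value is meaningless if \<open>p\<close>
  is not continuous.\<close>

definition has_circle_degree :: "(circle \<Rightarrow> circle) \<Rightarrow> int \<Rightarrow> bool" where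
  "has_circle_degree p n \<longleftrightarrow>
     (\<exists>P :: real \<Rightarrow> real. continuous_on UNIV P \<and> (\<forall>x. circle_of (P x) = p (circle_of x)) \<and>
        (\<forall>x. P (x + 1) = P x + of_int n))"

definition circle_degree :: "(circle \<Rightarrow> circle) \<Rightarrow> int" where
  "circle_degree p = (THE n. has_circle_degree p n)"

definition skew_map :: "int ^ 'n ^ 'n \<Rightarrow> (circle \<Rightarrow> circle ^ 'n) \<Rightarrow> real
    \<Rightarrow> (circle ^ 'n) \<times> circle \<Rightarrow> (circle ^ 'n) \<times> circle" where
  "skew_map A h \<alpha> = (\<lambda>(v, \<omega>). (torus_endo A v + h \<omega>, \<omega> + circle_of \<alpha>))"

definition fibre_graph :: "(circle \<Rightarrow> 'a) \<Rightarrow> ('a \<times> circle) set" where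
  "fibre_graph g = {(g \<omega>, \<omega>) | \<omega>. True}"

definition random_periodic_point ::
  "('a :: topological_space \<times> circle \<Rightarrow> 'a \<times> circle) \<Rightarrow> (circle \<Rightarrow> 'a) \<Rightarrow> bool" where
  "random_periodic_point \<phi> g \<longleftrightarrow>
     g \<in> borel_measurable borel \<and> (\<exists>n\<ge>1. (\<phi> ^^ n) ` fibre_graph g = fibre_graph g)"

lemma continuous_circle_of: "continuous_on UNIV circle_of"
  unfolding continuous_on_open_vimage[OF open_UNIV] by (simp add: open_circle_def)

lemma circle_of_eq_iff: "circle_of x = circle_of y \<longleftrightarrow> x - y \<in> \<int>"
  by (rule circle.abs_eq_iff)

lemma circle_lifts_differ_by_constant:
  fixes P Q :: "real \<Rightarrow> real"
  assumes "continuous_on UNIV P" "continuous_on UNIV Q"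
    and "\<And>x. circle_of (P x) = circle_of (Q x)"
  shows "\<exists>k :: int. \<forall>x. P x = Q x + of_int k"
proof -
  have Z: "P x - Q x \<in> \<int>" for x
    using assms(3) by (simp add: circle_of_eq_iff)
  have "(\<lambda>x. P x - Q x) constant_on UNIV"
  proof (rule continuous_discrete_range_constant)
    show "continuous_on UNIV (\<lambda>x. P x - Q x)"
      by (intro continuous_intros assms)
    show "\<exists>e>0. \<forall>y. y \<in> UNIV \<and> P y - Q y \<noteq> P x - Q x \<longrightarrow>
        e \<le> norm (P y - Q y - (P x - Q x))" for x
      using Z by (intro exI[of _ 1]) (auto intro!: Ints_nonzero_abs_ge1)
  qed auto
  then obtain c where c: "\<And>x. P x - Q x = c"
    by (auto simp: constant_on_def)
  with Z[of 0] obtain k where "c = of_int k"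
    by (auto elim: Ints_cases)
  with c show ?thesis
    by (auto simp: diff_eq_eq add.commute)
qed

lift_definition circle_to_complex :: "circle \<Rightarrow> complex" is "\<lambda>x. cis (2 * pi * x)"
proof -
  fix x y :: real
  assume "x - y \<in> \<int>"
  then have "cis (2 * pi * (x - y)) = 1"
    by (rule cis_multiple_2pi)
  moreover have "cis (2 * pi * x) = cis (2 * pi * (x - y)) * cis (2 * pi * y)"
    unfolding cis_mult by (rule arg_cong[of _ _ cis]) (simp add: algebra_simps)
  ultimately show "cis (2 * pi * x) = cis (2 * pi * y)"
    by simp
qed

lemma continuous_circle_to_complex: "continuous_on UNIV circle_to_complex"
proof -
  have "open (circle_of -` (circle_to_complex -` U))" if "open U" for U
  proof -
    have "circle_of -` (circle_to_complex -` U) = (\<lambda>x. cis (2 * pi * x)) -` U"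
      by (auto simp: circle_to_complex.abs_eq)
    moreover have "continuous_on UNIV (\<lambda>x. cis (2 * pi * x))"
      by (intro continuous_intros)
    ultimately show ?thesis
      using that by (simp add: open_vimage)
  qed
  then show ?thesis
    by (simp add: continuous_on_open_vimage open_circle_def)
qed

lemma inj_circle_to_complex: "inj circle_to_complex"
proof (rule injI, transfer)
  fix x y :: real
  assume "cis (2 * pi * x) = cis (2 * pi * y)"
  then have "sin (2 * pi * x) = sin (2 * pi * y) \<and> cos (2 * pi * x) = cos (2 * pi * y)"
    by (simp add: complex_eq_iff)
  then obtain n where "2 * pi * x = 2 * pi * y + 2 * pi * of_int n"
    by (subst (asm) sin_cos_eq_iff) auto
  then have "2 * pi * (x - y) = 2 * pi * of_int n"
    by (simp add: algebra_simps)
  then show "x - y \<in> \<int>"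
    by simp
qed

lemma circle_lift_exists:
  assumes "continuous_on UNIV f"
  shows "\<exists>P :: real \<Rightarrow> real. continuous_on UNIV P \<and> (\<forall>x. circle_of (P x) = f x)"
proof -
  have norm1: "norm (circle_to_complex z) = 1" for z
    by transfer simp
  have "continuous_on UNIV (\<lambda>x. circle_to_complex (f x))"
    by (rule continuous_on_compose2[OF continuous_circle_to_complex assms]) auto
  moreover have "circle_to_complex (f x) \<noteq> 0" for x
    using norm1[of "f x"] by auto
  ultimately obtain g where g: "continuous_on UNIV g"
      and gf: "\<And>x :: real. circle_to_complex (f x) = exp (g x)"
    using continuous_logarithm_on_contractible[of UNIV "\<lambda>x :: real. circle_to_complex (f x)"]
    by (metis UNIV_I contractible_UNIV)
  have "circle_of (Im (g x) / (2 * pi)) = f x" for x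
  proof -
    have "exp (Re (g x)) = 1"
      using norm1[of "f x"] by (simp only: gf norm_exp_eq_Re)
    then have "exp (g x) = cis (Im (g x))"
      by (simp add: exp_eq_polar)
    then have "circle_to_complex (circle_of (Im (g x) / (2 * pi))) = circle_to_complex (f x)"
      by (simp add: circle_to_complex.abs_eq gf)
    then show ?thesis
      using inj_circle_to_complex by (simp add: inj_eq)
  qed
  moreover have "continuous_on UNIV (\<lambda>x. Im (g x) / (2 * pi))"
    by (intro continuous_intros g) auto
  ultimately show ?thesis
    by blast
qed

lemma circle_degree_unique:
  assumes "continuous_on UNIV p"
  shows "\<exists>!n. has_circle_degree p n"
proof (rule ex_ex1I)
  have "continuous_on UNIV (\<lambda>x. p (circle_of x))"
    by (rule continuous_on_compose2[OF assms continuous_circle_of]) auto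
  then obtain P where P: "continuous_on UNIV P" "\<And>x. circle_of (P x) = p (circle_of x)"
    using circle_lift_exists by blast
  have "circle_of (x + 1) = circle_of x" for x
    by (simp add: circle_of_eq_iff)
  then have "\<exists>k :: int. \<forall>x. P (x + 1) = P x + of_int k"
    by (intro circle_lifts_differ_by_constant continuous_on_compose2[OF P(1)] P(1) continuous_intros)
      (auto simp: P(2))
  with P show "\<exists>n. has_circle_degree p n"
    unfolding has_circle_degree_def by blast
next
  fix m n
  assume "has_circle_degree p m" "has_circle_degree p n"
  then obtain P Q where PQ: "continuous_on UNIV P" "continuous_on UNIV Q"
      "\<And>x. circle_of (P x) = p (circle_of x)" "\<And>x. circle_of (Q x) = p (circle_of x)"
      "\<And>x. P (x + 1) = P x + of_int m" "\<And>x. Q (x + 1) = Q x + of_int n"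
    unfolding has_circle_degree_def by blast
  then obtain k :: int where k: "\<And>x. P x = Q x + of_int k"
    using circle_lifts_differ_by_constant[of P Q] by auto
  have "of_int m = (of_int n :: real)"
    using PQ(5)[of 0] PQ(6)[of 0] k[of 0] k[of 1] by simp
  then show "m = n"
    by simp
qed

end

theory Submission
  imports Defs
begin

text \<open>
  The skew map \<open>\<phi>\<close> sends the graph of \<open>g\<close> to the graph of another section, and this graph transform
  acts on degrees by an affine map: if \<open>g\<close> has the degree vector \<open>d\<close> and \<open>h\<close> has \<open>N\<close>,
  then the image section has \<open>A d + N\<close>, because degrees are additive and do not see the rotation by
  \<open>\<alpha>\<close> (lemma \<open>degree_vector_graph_transform\<close>). A section with \<open>\<phi>\<^sup>n(graph g) = graph g\<close> therefore
  has a degree vector that is periodic under \<open>d \<mapsto> A d + N\<close>.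

  Such a vector cannot exist over the integers when \<open>n\<^sub>2\<close> is odd
  (lemma \<open>affine_orbit_not_periodic\<close>). The row vector \<open>(\<surd>2, 1)\<close> is a left eigenvector of \<open>A\<close>
  with eigenvalue \<open>1 + \<surd>2\<close>, so \<open>\<surd>2 d\<^sub>1 + d\<^sub>2\<close> evolves by an expanding affine map of the line,
  whose only periodic point is its fixed point. At the fixed point
  \<open>2 d\<^sub>1 + n\<^sub>2 = - \<surd>2 (d\<^sub>2 + n\<^sub>1)\<close>; the two squares are integers of different parity.
\<close>

section \<open>Degrees of circle maps\<close>

lemma has_circle_degree_circle_degree:
  assumes "continuous_on UNIV p"
  shows "has_circle_degree p (circle_degree p)"
  unfolding circle_degree_def using circle_degree_unique[OF assms] by (rule theI')

lemma has_circle_degree_continuous: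
  assumes "has_circle_degree p m"
  shows "continuous_on UNIV p"
proof -
  obtain P where P: "continuous_on UNIV P" "\<And>x. circle_of (P x) = p (circle_of x)"
    using assms unfolding has_circle_degree_def by blast
  have "continuous_on UNIV (\<lambda>x. circle_of (P x))"
    by (rule continuous_on_compose2[OF continuous_circle_of P(1)]) auto
  then have "open (circle_of -` (p -` U))" if "open U" for U
    using that open_vimage[of U "\<lambda>x. circle_of (P x)"] by (simp add: P(2) vimage_def)
  then show ?thesis
    by (simp add: continuous_on_open_vimage open_circle_def)
qed

lemma has_circle_degree_inject:
  assumes "has_circle_degree p m" "has_circle_degree p n"
  shows "m = n"
  using circle_degree_unique[OF has_circle_degree_continuous[OF assms(1)]] assms by blast

lemma has_circle_degree_zero: "has_circle_degree (\<lambda>_. 0) 0"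
  unfolding has_circle_degree_def
  by (rule exI[of _ "\<lambda>_. 0"]) (simp add: zero_circle.abs_eq)

lemma has_circle_degree_add:
  assumes "has_circle_degree p m" "has_circle_degree q n"
  shows "has_circle_degree (\<lambda>\<omega>. p \<omega> + q \<omega>) (m + n)"
proof -
  obtain P Q where "continuous_on UNIV P" "\<And>x. circle_of (P x) = p (circle_of x)"
      "\<And>x. P (x + 1) = P x + of_int m"
      "continuous_on UNIV Q" "\<And>x. circle_of (Q x) = q (circle_of x)"
      "\<And>x. Q (x + 1) = Q x + of_int n"
    using assms unfolding has_circle_degree_def by blast
  then show ?thesis
    unfolding has_circle_degree_def
    by (intro exI[of _ "\<lambda>x. P x + Q x"])
      (auto intro!: continuous_intros simp flip: plus_circle.abs_eq)
qed

lemma has_circle_degree_sum: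
  assumes "\<And>j. j \<in> J \<Longrightarrow> has_circle_degree (p j) (m j)"
  shows "has_circle_degree (\<lambda>\<omega>. \<Sum>j\<in>J. p j \<omega>) (\<Sum>j\<in>J. m j)"
  using assms
  by (induction J rule: infinite_finite_induct)
    (simp_all add: has_circle_degree_zero has_circle_degree_add)

lemma has_circle_degree_scale:
  assumes "has_circle_degree p m"
  shows "has_circle_degree (\<lambda>\<omega>. circle_scale k (p \<omega>)) (k * m)"
proof -
  obtain P where "continuous_on UNIV P" "\<And>x. circle_of (P x) = p (circle_of x)"
      "\<And>x. P (x + 1) = P x + of_int m"
    using assms unfolding has_circle_degree_def by blast
  then show ?thesis
    unfolding has_circle_degree_def
    by (intro exI[of _ "\<lambda>x. of_int k * P x"])
      (auto intro!: continuous_intros simp: algebra_simps simp flip: circle_scale.abs_eq)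
qed

lemma has_circle_degree_rotate:
  assumes "has_circle_degree p m"
  shows "has_circle_degree (\<lambda>\<omega>. p (\<omega> - circle_of \<beta>)) m"
proof -
  obtain P where P: "continuous_on UNIV P" "\<And>x. circle_of (P x) = p (circle_of x)"
      "\<And>x. P (x + 1) = P x + of_int m"
    using assms unfolding has_circle_degree_def by blast
  have "continuous_on UNIV (\<lambda>x. P (x - \<beta>))"
    by (rule continuous_on_compose2[OF P(1)]) (auto intro!: continuous_intros)
  moreover have "P (x + 1 - \<beta>) = P (x - \<beta>) + of_int m" for x
    using P(3)[of "x - \<beta>"] by (simp add: algebra_simps)
  ultimately show ?thesis
    unfolding has_circle_degree_def
    by (intro exI[of _ "\<lambda>x. P (x - \<beta>)"]) (simp add: P(2) minus_circle.abs_eq)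
qed

section \<open>The graph transform\<close>

definition graph_transform ::
  "int ^ 'n ^ 'n \<Rightarrow> (circle \<Rightarrow> circle ^ 'n) \<Rightarrow> real \<Rightarrow> (circle \<Rightarrow> circle ^ 'n) \<Rightarrow> circle \<Rightarrow> circle ^ 'n"
  where "graph_transform A h \<alpha> g \<omega> =
    torus_endo A (g (\<omega> - circle_of \<alpha>)) + h (\<omega> - circle_of \<alpha>)"

lemma fibre_graph_eq_iff: "fibre_graph f = fibre_graph g \<longleftrightarrow> f = g"
  by (auto simp: fibre_graph_def set_eq_iff)

lemma fibre_graph_eq_range_rotated:
  "fibre_graph f = range (\<lambda>\<omega>. (f (\<omega> + c), \<omega> + c))"
proof (intro equalityI subsetI)
  fix z assume "z \<in> fibre_graph f"
  then obtain \<omega> where "z = (f \<omega>, \<omega>)"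
    by (auto simp: fibre_graph_def)
  then show "z \<in> range (\<lambda>\<omega>. (f (\<omega> + c), \<omega> + c))"
    by (intro image_eqI[of _ _ "\<omega> - c"]) auto
qed (auto simp: fibre_graph_def)

lemma skew_map_image_fibre_graph:
  "skew_map A h \<alpha> ` fibre_graph g = fibre_graph (graph_transform A h \<alpha> g)"
  unfolding fibre_graph_eq_range_rotated[of g 0]
    fibre_graph_eq_range_rotated[of "graph_transform A h \<alpha> g" "circle_of \<alpha>"]
  by (simp add: image_image skew_map_def graph_transform_def)

lemma skew_map_power_image_fibre_graph:
  "(skew_map A h \<alpha> ^^ k) ` fibre_graph g = fibre_graph ((graph_transform A h \<alpha> ^^ k) g)"
proof (induction k)
  case (Suc k)
  have "(skew_map A h \<alpha> ^^ Suc k) ` fibre_graph g =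
      skew_map A h \<alpha> ` (skew_map A h \<alpha> ^^ k) ` fibre_graph g"
    by (simp add: image_image)
  then show ?case
    by (simp add: Suc.IH skew_map_image_fibre_graph)
qed simp

definition has_degree_vector :: "(circle \<Rightarrow> circle ^ 'n) \<Rightarrow> int ^ 'n \<Rightarrow> bool" where
  "has_degree_vector g d \<longleftrightarrow> (\<forall>i. has_circle_degree (\<lambda>\<omega>. g \<omega> $ i) (d $ i))"

lemma continuous_has_degree_vector:
  assumes "continuous_on UNIV g"
  shows "has_degree_vector g (\<chi> i. circle_degree (\<lambda>\<omega>. g \<omega> $ i))"
  unfolding has_degree_vector_def
  by (auto intro!: has_circle_degree_circle_degree continuous_on_component assms)

lemma has_degree_vector_inject:
  assumes "has_degree_vector g d" "has_degree_vector g d'"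
  shows "d = d'"
  using assms has_circle_degree_inject unfolding has_degree_vector_def vec_eq_iff by blast

lemma degree_vector_graph_transform:
  assumes "has_degree_vector g d" "has_degree_vector h N"
  shows "has_degree_vector (graph_transform A h \<alpha> g) (A *v d + N)"
  unfolding has_degree_vector_def
proof
  fix i
  have g: "has_circle_degree (\<lambda>\<omega>. g (\<omega> - circle_of \<alpha>) $ j) (d $ j)" for j
    using assms(1) has_circle_degree_rotate[of "\<lambda>\<omega>. g \<omega> $ j"]
    by (simp add: has_degree_vector_def)
  have h: "has_circle_degree (\<lambda>\<omega>. h (\<omega> - circle_of \<alpha>) $ i) (N $ i)"
    using assms(2) has_circle_degree_rotate[of "\<lambda>\<omega>. h \<omega> $ i"]
    by (simp add: has_degree_vector_def)
  have "has_circle_degree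
      (\<lambda>\<omega>. (\<Sum>j\<in>UNIV. circle_scale (A $ i $ j) (g (\<omega> - circle_of \<alpha>) $ j)) + h (\<omega> - circle_of \<alpha>) $ i)
      ((\<Sum>j\<in>UNIV. A $ i $ j * d $ j) + N $ i)"
    by (intro has_circle_degree_add has_circle_degree_sum has_circle_degree_scale g h)
  then show "has_circle_degree (\<lambda>\<omega>. graph_transform A h \<alpha> g \<omega> $ i) ((A *v d + N) $ i)"
    by (simp add: graph_transform_def torus_endo_def matrix_vector_mult_def)
qed

lemma degree_vector_graph_transform_power:
  assumes "has_degree_vector g d" "has_degree_vector h N"
  shows "has_degree_vector ((graph_transform A h \<alpha> ^^ k) g) (((\<lambda>v. A *v v + N) ^^ k) d)"
  using assms by (induction k) (simp_all add: degree_vector_graph_transform)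

section \<open>Periodic degree vectors\<close>

text \<open>Along the orbit, \<open>\<surd>2 v\<^sub>1 + v\<^sub>2\<close> minus its fixed value is a geometric sequence of ratio
  \<open>1 + \<surd>2\<close>, which returns to its start only if it is constantly zero. The parity of \<open>N\<^sub>2\<close>
  excludes zero for integer vectors.\<close>

lemma affine_orbit_not_periodic:
  fixes d N :: "int ^ 2"
  assumes "odd (N $ 2)" and "n > 0"
  shows "((\<lambda>v. vector [vector [1, 1], vector [2, 1]] *v v + N) ^^ n) d \<noteq> d"
proof
  let ?F = "\<lambda>v. vector [vector [1, 1], vector [2, 1]] *v v + N"
  assume periodic: "(?F ^^ n) d = d"
  define s where "s = sqrt 2"
  have ss: "s * s = 2" and s: "s > 0"
    by (simp_all add: s_def)
  \<comment> \<open>\<open>s\<close> times the eigenfunctional, shifted so that the affine map scales it by \<open>1 + s\<close>\<close>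
  define L where "L v = (2 * of_int (v $ 1) + of_int (N $ 2)) + s * (of_int (v $ 2) + of_int (N $ 1))"
    for v :: "int ^ 2"
  have L_step: "L (?F v) = (1 + s) * L v" for v
  proof -
    have "s * (s * x) = 2 * x" for x :: real
      using ss by (simp only: flip: mult.assoc)
    note this [simp]
    show ?thesis
      by (simp add: L_def matrix_vector_mult_def sum_2 algebra_simps)
  qed
  have "L ((?F ^^ k) d) = (1 + s) ^ k * L d" for k
    by (induction k) (simp_all only: funpow.simps o_apply id_apply L_step, simp_all)
  then have "L d = (1 + s) ^ n * L d"
    using periodic by metis
  moreover have "(1 + s) ^ n > 1"
    using s \<open>n > 0\<close> by (simp add: one_less_power)
  ultimately have "L d = 0"
    by simp
  then have "real_of_int (2 * d $ 1 + N $ 2) = - s * of_int (d $ 2 + N $ 1)"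
    by (simp add: L_def)
  then have "real_of_int ((2 * d $ 1 + N $ 2)\<^sup>2) = of_int (2 * (d $ 2 + N $ 1)\<^sup>2)"
    using ss by (simp add: power_mult_distrib power2_eq_square[of s])
  then have "(2 * d $ 1 + N $ 2)\<^sup>2 = 2 * (d $ 2 + N $ 1)\<^sup>2"
    by (simp only: of_int_eq_iff)
  then have "even ((2 * d $ 1 + N $ 2)\<^sup>2)"
    by simp
  with \<open>odd (N $ 2)\<close> show False
    by simp
qed

theorem lemma8p7:
  fixes \<alpha> :: real and A :: "int ^ 2 ^ 2" and h :: "circle \<Rightarrow> circle ^ 2"
    and \<phi> :: "(circle ^ 2) \<times> circle \<Rightarrow> (circle ^ 2) \<times> circle" and n1 n2 :: int
  assumes "\<alpha> \<notin> \<rat>"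
    and "A = vector [vector [1, 1], vector [2, 1]]"
    and "continuous_on UNIV h"
    and "\<phi> = skew_map A h \<alpha>"
    and "n1 = circle_degree (\<lambda>\<omega>. h \<omega> $ 1)"
    and "n2 = circle_degree (\<lambda>\<omega>. h \<omega> $ 2)"
    and "odd n2"
  shows "\<not> (\<exists>g :: circle \<Rightarrow> circle ^ 2. \<exists>n :: nat. continuous_on UNIV g \<and> n > 0 \<and>
            (\<phi> ^^ n) ` fibre_graph g = fibre_graph g) \<and>
         \<not> (\<exists>g. random_periodic_point \<phi> g \<and> continuous_on UNIV g)"
proof -
  have no_periodic: "(\<phi> ^^ n) ` fibre_graph g \<noteq> fibre_graph g"
    if g: "continuous_on UNIV g" and n: "n > 0" for g n
  proof
    assume "(\<phi> ^^ n) ` fibre_graph g = fibre_graph g"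
    then have fixed: "(graph_transform A h \<alpha> ^^ n) g = g"
      by (simp add: assms(4) skew_map_power_image_fibre_graph fibre_graph_eq_iff)
    define d where "d = (\<chi> i. circle_degree (\<lambda>\<omega>. g \<omega> $ i))"
    define N where "N = (\<chi> i. circle_degree (\<lambda>\<omega>. h \<omega> $ i))"
    have gd: "has_degree_vector g d" and hN: "has_degree_vector h N"
      unfolding d_def N_def using g assms(3) by (simp_all add: continuous_has_degree_vector)
    have "((\<lambda>v. A *v v + N) ^^ n) d = d"
      using degree_vector_graph_transform_power[OF gd hN, where A = A and \<alpha> = \<alpha> and k = n] gd
      unfolding fixed by (rule has_degree_vector_inject)
    moreover have "odd (N $ 2)"
      using assms(6,7) by (simp add: N_def)
    ultimately show False
      using affine_orbit_not_periodic[OF _ n, of N d] by (simp add: assms(2))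
  qed
  then show ?thesis
    unfolding random_periodic_point_def by (metis less_eq_Suc_le One_nat_def)
qed

end
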